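(* Let $M(n)$ be the number of equivalence classes of bitrades in $Q_3^n$. Then $M(n)\ge 2^{(2/3-o(1))n}$ as $n\to\infty$; that is, for every $\varepsilon>0$ there is $n_0$ such that $M(n)\ge 2^{(2/3-\varepsilon)n}$ for all $n\ge n_0$.
   Context: $Q_3$ is a set of $3$ symbols. A one-dimensional face of $Q_3^n$ is a set of $3$ words obtained by fixing the values of all coordinates but one. A unitrade is a set $U\subset Q_3^n$ whose intersection with every one-dimensional face has cardinality $0$ or $2$. The Hamming graph on $Q_3^n$ joins two words when they differ in exactly one coordinate. A bitrade is a unitrade $U$ such that the subgraph of the Hamming graph induced by $U$ is bipartite. Two subsets of $Q_3^n$ are equivalent if one is mapped to the other by an isometry of $Q_3^n$ (with the Hamming distance), i.e. by a composition of a permutation of coordinates and permutations of the alphabet $Q_3$ in each coordinate. *)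

theory Defs
  imports Complex_Main "HOL-Library.FuncSet" "HOL-Library.Numeral_Type"
    "HOL-Combinatorics.Permutations"
begin

text \<open>The alphabet is the three-element type \<^typ>\<open>3\<close>; the coordinates of a word are numbered from 0,
  and a word is \<^const>\<open>undefined\<close> outside \<open>{..<n}\<close>.\<close>

definition Q3 :: "nat \<Rightarrow> (nat \<Rightarrow> 3) set" where
  "Q3 n = {..<n} \<rightarrow>\<^sub>E UNIV"

definition hamming :: "nat \<Rightarrow> (nat \<Rightarrow> 3) \<Rightarrow> (nat \<Rightarrow> 3) \<Rightarrow> nat" where
  "hamming n x y = card {i \<in> {..<n}. x i \<noteq> y i}"

definition line :: "(nat \<Rightarrow> 3) \<Rightarrow> nat \<Rightarrow> (nat \<Rightarrow> 3) set" where
  "line x i = {x(i := a) | a. a \<in> UNIV}"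

definition unitrade :: "nat \<Rightarrow> (nat \<Rightarrow> 3) set \<Rightarrow> bool" where
  "unitrade n U \<longleftrightarrow> U \<subseteq> Q3 n \<and> (\<forall>x\<in>Q3 n. \<forall>i<n. card (U \<inter> line x i) \<in> {0, 2})"

definition hamming_adj :: "nat \<Rightarrow> (nat \<Rightarrow> 3) \<Rightarrow> (nat \<Rightarrow> 3) \<Rightarrow> bool" where
  "hamming_adj n x y \<longleftrightarrow> x \<in> Q3 n \<and> y \<in> Q3 n \<and> (\<exists>!i. i < n \<and> x i \<noteq> y i)"

text \<open>Bipartiteness of the subgraph induced on \<open>V\<close> by the adjacency relation \<open>adj\<close>.\<close>

definition induced_bipartite :: "('a \<Rightarrow> 'a \<Rightarrow> bool) \<Rightarrow> 'a set \<Rightarrow> bool" where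
  "induced_bipartite adj V \<longleftrightarrow>
     (\<exists>A B. A \<union> B = V \<and> A \<inter> B = {} \<and>
        (\<forall>x\<in>V. \<forall>y\<in>V. adj x y \<longrightarrow> x \<in> A \<and> y \<in> B \<or> x \<in> B \<and> y \<in> A))"

definition bitrade :: "nat \<Rightarrow> (nat \<Rightarrow> 3) set \<Rightarrow> bool" where
  "bitrade n U \<longleftrightarrow> unitrade n U \<and> induced_bipartite (hamming_adj n) U"

definition hamming_isometry :: "nat \<Rightarrow> ((nat \<Rightarrow> 3) \<Rightarrow> (nat \<Rightarrow> 3)) \<Rightarrow> bool" where
  "hamming_isometry n f \<longleftrightarrow> bij_betw f (Q3 n) (Q3 n) \<and>
     (\<forall>x\<in>Q3 n. \<forall>y\<in>Q3 n. hamming n (f x) (f y) = hamming n x y)"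

definition equivalence :: "nat \<Rightarrow> ((nat \<Rightarrow> 3) set \<times> (nat \<Rightarrow> 3) set) set" where
  "equivalence n = {(U, V). U \<subseteq> Q3 n \<and> V \<subseteq> Q3 n \<and> (\<exists>f. hamming_isometry n f \<and> f ` U = V)}"

definition num_bitrade_classes :: "nat \<Rightarrow> nat" where
  "num_bitrade_classes n = card ({U. bitrade n U} // equivalence n)"

lemma finite_Q3: "finite (Q3 n)"
  unfolding Q3_def by (simp add: finite_PiE)

lemma equiv_equivalence: "equiv (Pow (Q3 n)) (equivalence n)"
proof (rule equivI)
  show "equivalence n \<subseteq> Pow (Q3 n) \<times> Pow (Q3 n)"
    unfolding equivalence_def by auto
  have "hamming_isometry n id"
    unfolding hamming_isometry_def by auto
  then show "refl_on (Pow (Q3 n)) (equivalence n)"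
    unfolding refl_on_def equivalence_def by (auto intro!: exI[of _ id])
  show "sym (equivalence n)"
  proof (rule symI)
    fix U V assume "(U, V) \<in> equivalence n"
    then obtain f where UV: "U \<subseteq> Q3 n" "V \<subseteq> Q3 n" and f: "hamming_isometry n f" and V: "f ` U = V"
      unfolding equivalence_def by blast
    let ?g = "inv_into (Q3 n) f"
    have bij: "bij_betw f (Q3 n) (Q3 n)"
      using f unfolding hamming_isometry_def by blast
    have gbij: "bij_betw ?g (Q3 n) (Q3 n)"
      using bij by (rule bij_betw_inv_into)
    have fg: "f (?g x) = x" if "x \<in> Q3 n" for x
      using bij that by (rule bij_betw_inv_into_right)
    have "hamming n (?g x) (?g y) = hamming n x y" if "x \<in> Q3 n" "y \<in> Q3 n" for x y
      using f fg that bij_betwE[OF gbij] unfolding hamming_isometry_def by metis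
    then have "hamming_isometry n ?g"
      using gbij unfolding hamming_isometry_def by blast
    moreover have "?g ` V = U"
      using UV V bij by (metis bij_betw_def inv_into_image_cancel)
    ultimately show "(V, U) \<in> equivalence n"
      using UV unfolding equivalence_def by blast
  qed
  show "trans (equivalence n)"
  proof (rule transI)
    fix U V W assume "(U, V) \<in> equivalence n" "(V, W) \<in> equivalence n"
    then obtain f g where *: "U \<subseteq> Q3 n" "W \<subseteq> Q3 n" "hamming_isometry n f" "hamming_isometry n g"
      "f ` U = V" "g ` V = W"
      unfolding equivalence_def by blast
    have "bij_betw (g \<circ> f) (Q3 n) (Q3 n)"
      using * unfolding hamming_isometry_def by (blast intro: bij_betw_trans)
    moreover have "hamming n (g (f x)) (g (f y)) = hamming n x y" if "x \<in> Q3 n" "y \<in> Q3 n" for x y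
    proof -
      have "f x \<in> Q3 n" "f y \<in> Q3 n"
        using *(3) that unfolding hamming_isometry_def by (blast dest: bij_betwE)+
      then show ?thesis
        using *(3,4) that unfolding hamming_isometry_def by simp
    qed
    ultimately have "hamming_isometry n (g \<circ> f)"
      unfolding hamming_isometry_def by simp
    moreover have "(g \<circ> f) ` U = W"
      using *(5,6) by (auto simp: image_iff)
    ultimately show "(U, W) \<in> equivalence n"
      using * unfolding equivalence_def by blast
  qed
qed

lemma hamming_adj_iff:
  assumes "x \<in> Q3 n" "y \<in> Q3 n"
  shows "hamming_adj n x y \<longleftrightarrow> hamming n x y = 1"
proof -
  have "(\<exists>!i. i < n \<and> x i \<noteq> y i) \<longleftrightarrow> (\<exists>i. {i \<in> {..<n}. x i \<noteq> y i} = {i})"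
    unfolding Ex1_def set_eq_iff by (intro iff_exI) auto
  then show ?thesis
    using assms unfolding hamming_adj_def hamming_def by (simp add: card_1_singleton_iff)
qed

lemma hamming_remove:
  assumes "k < n"
  shows "hamming n x y =
    (if x k = y k then 0 else 1) + card {i \<in> {..<n}. i \<noteq> k \<and> x i \<noteq> y i}"
proof -
  have *: "{i \<in> {..<n}. x i \<noteq> y i} =
    (if x k = y k then {} else {k}) \<union> {i \<in> {..<n}. i \<noteq> k \<and> x i \<noteq> y i}"
    using assms by auto
  show ?thesis
    unfolding hamming_def by (subst *, subst card_Un_disjoint) auto
qed

lemma hamming_eq_if_closer:
  assumes "k < n" and "\<And>i. i < n \<Longrightarrow> i \<noteq> k \<Longrightarrow> u i = v i"
    and "hamming n w v = Suc (hamming n w u)"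
  shows "w k = u k"
proof -
  have "{i \<in> {..<n}. i \<noteq> k \<and> w i \<noteq> u i} = {i \<in> {..<n}. i \<noteq> k \<and> w i \<noteq> v i}"
    using assms(2) by auto
  then show ?thesis
    using assms(3) unfolding hamming_remove[OF assms(1)] by (auto split: if_splits)
qed

text \<open>The isometries are exactly the maps composed of a permutation \<open>p\<close> of the coordinates and
  permutations \<open>g i\<close> of the alphabet.\<close>

lemma hamming_isometry_iff:
  "hamming_isometry n f \<longleftrightarrow>
     (\<exists>p g. p permutes {..<n} \<and> (\<forall>i<n. bij (g i)) \<and>
        (\<forall>x\<in>Q3 n. f x = (\<lambda>i\<in>{..<n}. g i (x (p i)))))"
proof
  assume "\<exists>p g. p permutes {..<n} \<and> (\<forall>i<n. bij (g i)) \<and>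
        (\<forall>x\<in>Q3 n. f x = (\<lambda>i\<in>{..<n}. g i (x (p i))))"
  then obtain p g where p: "p permutes {..<n}" and g: "\<And>i. i < n \<Longrightarrow> bij (g i)"
    and f: "\<And>x. x \<in> Q3 n \<Longrightarrow> f x = (\<lambda>i\<in>{..<n}. g i (x (p i)))"
    by blast
  have dist: "hamming n (f x) (f y) = hamming n x y" if "x \<in> Q3 n" "y \<in> Q3 n" for x y
  proof -
    have "p ` {i \<in> {..<n}. f x i \<noteq> f y i} = {i \<in> {..<n}. x i \<noteq> y i}" (is "p ` ?A = ?B")
    proof -
      have 1: "f x i \<noteq> f y i \<longleftrightarrow> x (p i) \<noteq> y (p i)" if "i < n" for i
        using f[OF \<open>x \<in> Q3 n\<close>] f[OF \<open>y \<in> Q3 n\<close>] that g[OF that] by (simp add: bij_def inj_eq)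
      have 2: "p i < n \<longleftrightarrow> i < n" for i
        using permutes_in_image[OF p, of i] by simp
      show ?thesis
      proof (intro equalityI subsetI)
        fix j assume "j \<in> p ` ?A"
        then show "j \<in> ?B" using 1 2 by auto
      next
        fix j assume j: "j \<in> ?B"
        obtain i where "j = p i" using permutes_surj[OF p] by (metis surjD)
        then show "j \<in> p ` ?A" using j 1 2 by auto
      qed
    qed
    moreover have "inj_on p ?A" using permutes_inj[OF p] by (rule inj_on_subset) simp
    ultimately show ?thesis
      unfolding hamming_def using card_image[of p ?A] by simp
  qed
  have "inj_on f (Q3 n)"
  proof (rule inj_onI)
    fix x y assume xy: "x \<in> Q3 n" "y \<in> Q3 n" and "f x = f y"
    then have "hamming n x y = 0" using dist[of x y] by (simp add: hamming_def)
    then have "\<And>i. i < n \<Longrightarrow> x i = y i" unfolding hamming_def by auto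
    then show "x = y" using xy unfolding Q3_def by (auto intro: PiE_ext)
  qed
  moreover have "f ` Q3 n \<subseteq> Q3 n" using f by (auto simp: Q3_def)
  ultimately have "bij_betw f (Q3 n) (Q3 n)"
    using finite_Q3 by (simp add: bij_betw_def endo_inj_surj)
  then show "hamming_isometry n f"
    using dist unfolding hamming_isometry_def by blast
next
  assume "hamming_isometry n f"
  then have fQ: "\<And>x. x \<in> Q3 n \<Longrightarrow> f x \<in> Q3 n"
    and fd: "\<And>x y. x \<in> Q3 n \<Longrightarrow> y \<in> Q3 n \<Longrightarrow> hamming n (f x) (f y) = hamming n x y"
    unfolding hamming_isometry_def by (auto dest: bij_betwE)
  define z :: "nat \<Rightarrow> 3" where "z = (\<lambda>i\<in>{..<n}. 0)"
  have zQ: "z \<in> Q3 n" by (auto simp: z_def Q3_def)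
  have z0: "z i = 0" if "i < n" for i using that by (simp add: z_def)
  have zu: "z(i := a) \<in> Q3 n" if "i < n" for i a
    using that by (auto simp: z_def Q3_def PiE_def extensional_def)
  have d1: "hamming n (z(i := a)) (z(i := b)) = 1" if "i < n" "a \<noteq> b" for i a b
  proof -
    have "{j \<in> {..<n}. (z(i := a)) j \<noteq> (z(i := b)) j} = {i}" using that by auto
    then show ?thesis by (simp add: hamming_def)
  qed
  have one: "\<exists>k<n. u k \<noteq> v k \<and> (\<forall>j<n. j \<noteq> k \<longrightarrow> u j = v j)" if uv: "hamming n u v = 1" for u v
  proof -
    obtain k where "{j \<in> {..<n}. u j \<noteq> v j} = {k}"
      using uv unfolding hamming_def by (rule card_1_singletonE)
    then have "\<And>j. (j < n \<and> u j \<noteq> v j) \<longleftrightarrow> j = k" by (auto simp: set_eq_iff)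
    then show ?thesis by metis
  qed
  have "\<exists>k<n. \<forall>a b. \<forall>j<n. j \<noteq> k \<longrightarrow> f (z(i := a)) j = f (z(i := b)) j" if i: "i < n" for i
  proof -
    let ?u = "\<lambda>a. f (z(i := a))"
    have *: "hamming n (?u a) (?u b) = 1" if "a \<noteq> b" for a b
      using fd[OF zu zu] d1 that i by simp
    obtain k where k: "k < n" "?u 0 k \<noteq> ?u 1 k" "\<And>j. j < n \<Longrightarrow> j \<noteq> k \<Longrightarrow> ?u 0 j = ?u 1 j"
      using one[OF *[of 0 1]] by auto
    have "?u a j = ?u 0 j" if j: "j < n" "j \<noteq> k" for a j
    proof (rule ccontr)
      assume ne: "?u a j \<noteq> ?u 0 j"
      then have a: "a \<noteq> 0" "a \<noteq> 1" using k(3)[OF j] by auto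
      obtain l where l: "\<And>j. j < n \<Longrightarrow> j \<noteq> l \<Longrightarrow> ?u a j = ?u 0 j"
        using one[OF *[OF a(1)]] by auto
      obtain m where m: "\<And>j. j < n \<Longrightarrow> j \<noteq> m \<Longrightarrow> ?u a j = ?u 1 j"
        using one[OF *[OF a(2)]] by auto
      have "j = l" "j = m" using l[OF j(1)] m[OF j(1)] ne k(3)[OF j] by auto
      then show False using l[OF k(1)] m[OF k(1)] k(2) j(2) by auto
    qed
    then show ?thesis using k(1) by metis
  qed
  then obtain q where q: "\<And>i. i < n \<Longrightarrow> q i < n"
    and qeq: "\<And>i a b j. i < n \<Longrightarrow> j < n \<Longrightarrow> j \<noteq> q i \<Longrightarrow> f (z(i := a)) j = f (z(i := b)) j"
    by metis
  have zz: "z(i := 0) = z" if "i < n" for i using z0[OF that] by auto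
  define h where "h i a = f (z(i := a)) (q i)" for i a
  have key: "f w (q i) = h i (w i)" if w: "w \<in> Q3 n" and i: "i < n" for w i
  proof -
    obtain b :: 3 where b: "b \<noteq> w i" by (metis zero_neq_one)
    have "hamming n w (z(i := b)) = Suc (hamming n w (z(i := w i)))"
    proof -
      have "{j \<in> {..<n}. j \<noteq> i \<and> w j \<noteq> (z(i := b)) j} = {j \<in> {..<n}. j \<noteq> i \<and> w j \<noteq> (z(i := w i)) j}"
        by auto
      then show ?thesis using b unfolding hamming_remove[OF i] by simp
    qed
    then have "hamming n (f w) (f (z(i := b))) = Suc (hamming n (f w) (f (z(i := w i))))"
      using fd[OF w zu[OF i]] by simp
    with q[OF i] qeq[OF i] show ?thesis
      unfolding h_def by (rule hamming_eq_if_closer)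
  qed
  have hinj: "inj (h i)" if i: "i < n" for i
  proof (rule injI, rule ccontr)
    fix a b assume "h i a = h i b" "a \<noteq> b"
    then have "hamming n (f (z(i := a))) (f (z(i := b))) = 0"
      using qeq[OF i] unfolding h_def hamming_def by auto
    then show False using fd[OF zu zu] d1[OF i \<open>a \<noteq> b\<close>] i by simp
  qed
  have qinj: "inj_on q {..<n}"
  proof (rule inj_onI, rule ccontr)
    fix i j assume ij: "i \<in> {..<n}" "j \<in> {..<n}" "q i = q j" "i \<noteq> j"
    have "h i a = h i 0" for a
      using key[of "z(i := a)" j] key[of "z(i := 0)" j] zu ij unfolding h_def by simp
    then show False using hinj[of i] ij by (metis injD lessThan_iff zero_neq_one)
  qed
  have qbij: "bij_betw q {..<n} {..<n}"
  proof -
    have "q ` {..<n} \<subseteq> {..<n}" using q by auto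
    then show ?thesis using qinj endo_inj_surj[of "{..<n}" q] by (simp add: bij_betw_def)
  qed
  define p where "p j = (if j < n then inv_into {..<n} q j else j)" for j
  have qp: "q (p j) = j" "p j < n" if "j < n" for j
  proof -
    show "q (p j) = j"
      using bij_betw_inv_into_right[OF qbij, of j] that by (simp add: p_def)
    show "p j < n"
      using bij_betwE[OF bij_betw_inv_into[OF qbij]] that by (auto simp: p_def)
  qed
  have "p permutes {..<n}"
  proof (rule bij_imp_permutes)
    show "bij_betw p {..<n} {..<n}"
      using bij_betw_inv_into[OF qbij] by (rule bij_betw_cong[THEN iffD1, rotated]) (simp add: p_def)
    show "p j = j" if "j \<notin> {..<n}" for j using that by (simp add: p_def)
  qed
  moreover have "\<forall>j<n. bij (h (p j))"
    using hinj qp by (simp add: bij_def finite_UNIV_inj_surj)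
  moreover have "f x = (\<lambda>j\<in>{..<n}. h (p j) (x (p j)))" if x: "x \<in> Q3 n" for x
  proof
    fix j
    show "f x j = (\<lambda>j\<in>{..<n}. h (p j) (x (p j))) j"
    proof (cases "j < n")
      case True
      then show ?thesis using key[OF x qp(2)[OF True]] qp(1)[OF True] by simp
    next
      case False
      then show ?thesis using fQ[OF x] by (auto simp: Q3_def PiE_def extensional_def)
    qed
  qed
  ultimately show "\<exists>p g. p permutes {..<n} \<and> (\<forall>i<n. bij (g i)) \<and>
        (\<forall>x\<in>Q3 n. f x = (\<lambda>i\<in>{..<n}. g i (x (p i))))"
    by (intro exI[of _ p] exI[of _ "\<lambda>j. h (p j)"]) blast
qed

end

theory Submission
  imports Defs "HOL-Real_Asymp.Real_Asymp"
begin

text \<open>A bitrade is the support of a \<open>{-1, 0, 1}\<close>-valued function with zero line sums. If \<open>F\<close> is such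
  a function whose three layers in the last direction are \<open>f\<^sub>0, f\<^sub>1, f\<^sub>2\<close>, then \<open>f\<^sub>0 + f\<^sub>1 + f\<^sub>2 = 0\<close>, and
  for \<open>{j, k} = {1, 2}\<close> the array with rows \<open>F\<close>, (\<open>-f\<^sub>0\<close> in column 0, \<open>f\<^sub>0\<close> in column \<open>j\<close>) and
  (\<open>-f\<^sub>k\<close> in column \<open>k\<close>, \<open>f\<^sub>k\<close> in column \<open>j\<close>) is again such a function with one more coordinate.
  The layer sizes \<open>(x, y, z)\<close> become \<open>(x + y + z, 2x, 2y)\<close> or \<open>(x + y + z, 2x, 2z)\<close>, according to
  \<open>k\<close>. Once the powers of 2 dividing \<open>x, y, z\<close> are distinct, the whole sequence of choices can be
  read off the set \<open>{x, y, z}\<close>. An equivalence class determines at most \<open>n\<close> such sets, one for each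
  direction, so there are at least \<open>2 ^ (n - 4) / n\<close> classes.\<close>

section \<open>The alphabet, and bitrades from signed functions\<close>

lemma exhaust_three:
  fixes a :: 3
  shows "a = 0 \<or> a = 1 \<or> a = 2"
proof (induct a)
  case (of_int z)
  then have "z = 0 \<or> z = 1 \<or> z = 2" by auto
  then show ?case by auto
qed

lemma UNIV_three: "(UNIV :: 3 set) = {0, 1, 2}"
  using exhaust_three by auto

lemma distinct_three [simp]: "(0 :: 3) \<noteq> 2" "(1 :: 3) \<noteq> 2" "(2 :: 3) \<noteq> 0" "(2 :: 3) \<noteq> 1"
  by simp_all

text \<open>The domain is all of \<open>nat \<Rightarrow> 3\<close>; the second clause makes
  \<open>F\<close> depend on the first \<open>n\<close> coordinates only, so that coordinates can be
  appended freely.\<close>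

definition signed_bitrade :: "nat \<Rightarrow> ((nat \<Rightarrow> 3) \<Rightarrow> int) \<Rightarrow> bool" where
  "signed_bitrade n F \<longleftrightarrow>
     (\<forall>x. F x \<in> {-1, 0, 1}) \<and>
     (\<forall>x i a. i \<ge> n \<longrightarrow> F (x(i := a)) = F x) \<and>
     (\<forall>x i. i < n \<longrightarrow> F (x(i := 0)) + F (x(i := 1)) + F (x(i := 2)) = 0)"

definition support :: "nat \<Rightarrow> ((nat \<Rightarrow> 3) \<Rightarrow> int) \<Rightarrow> (nat \<Rightarrow> 3) set" where
  "support n F = {x \<in> Q3 n. F x \<noteq> 0}"

lemma Q3_upd: "x \<in> Q3 n \<Longrightarrow> i < n \<Longrightarrow> x(i := a) \<in> Q3 n"
  unfolding Q3_def by (auto simp: PiE_def extensional_def)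

text \<open>If two entries on a line were both 1 or both -1, the zero sum would force a third entry
  of -2 or 2.\<close>

lemma signed_bitrade_opposite:
  assumes F: "signed_bitrade n F" and "i < n" and "a \<noteq> b"
    and "F (x(i := a)) \<noteq> 0" "F (x(i := b)) \<noteq> 0"
  shows "F (x(i := a)) = - F (x(i := b))"
proof -
  have "F (x(i := c)) \<in> {-1, 0, 1}" for c
    using F unfolding signed_bitrade_def by blast
  note this[of 0] this[of 1] this[of 2]
  moreover have "F (x(i := 0)) + F (x(i := 1)) + F (x(i := 2)) = 0"
    using F \<open>i < n\<close> unfolding signed_bitrade_def by blast
  ultimately show ?thesis
    using assms(3-5) exhaust_three[of a] exhaust_three[of b] by auto
qed

text \<open>Zero line sums leave no nonzero entry or a pair 1, -1 on each line, so the sign is a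
  proper 2-colouring of the support.\<close>

lemma bitrade_support:
  assumes F: "signed_bitrade n F"
  shows "bitrade n (support n F)"
proof -
  have val: "F x \<in> {-1, 0, 1}" for x
    using F unfolding signed_bitrade_def by blast
  have "card (support n F \<inter> line x i) \<in> {0, 2}" if x: "x \<in> Q3 n" and i: "i < n" for x i
  proof -
    have "support n F \<inter> line x i = (\<lambda>a. x(i := a)) ` {a. F (x(i := a)) \<noteq> 0}"
      using Q3_upd[OF x i] unfolding support_def line_def by auto
    moreover have "inj_on (\<lambda>a. x(i := a)) A" for A
      by (rule inj_onI) (metis fun_upd_same)
    ultimately have "card (support n F \<inter> line x i) = card {a. F (x(i := a)) \<noteq> 0}"
      by (simp add: card_image)
    also have "{a. F (x(i := a)) \<noteq> 0} = Set.filter (\<lambda>a. F (x(i := a)) \<noteq> 0) {0, 1, 2}"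
      using UNIV_three by auto
    also have "card \<dots> \<in> {0, 2}"
    proof -
      have "F (x(i := 0)) + F (x(i := 1)) + F (x(i := 2)) = 0"
        using F i unfolding signed_bitrade_def by blast
      then consider "F (x(i := 0)) = 0" "F (x(i := 1)) = 0" "F (x(i := 2)) = 0"
        | "F (x(i := 0)) = 0" "F (x(i := 1)) \<noteq> 0" "F (x(i := 2)) \<noteq> 0"
        | "F (x(i := 0)) \<noteq> 0" "F (x(i := 1)) = 0" "F (x(i := 2)) \<noteq> 0"
        | "F (x(i := 0)) \<noteq> 0" "F (x(i := 1)) \<noteq> 0" "F (x(i := 2)) = 0"
        using val[of "x(i := 0)"] val[of "x(i := 1)"] val[of "x(i := 2)"] by auto
      then show ?thesis
      proof cases
        case 1
        then have "Set.filter (\<lambda>a. F (x(i := a)) \<noteq> 0) {0, 1, 2} = {}" by auto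
        then show ?thesis by simp
      next
        case 2
        then have "Set.filter (\<lambda>a. F (x(i := a)) \<noteq> 0) {0, 1, 2} = {1, 2}" by auto
        then show ?thesis by simp
      next
        case 3
        then have "Set.filter (\<lambda>a. F (x(i := a)) \<noteq> 0) {0, 1, 2} = {0, 2}" by auto
        then show ?thesis by simp
      next
        case 4
        then have "Set.filter (\<lambda>a. F (x(i := a)) \<noteq> 0) {0, 1, 2} = {0, 1}" by auto
        then show ?thesis by simp
      qed
    qed
    finally show ?thesis .
  qed
  then have "unitrade n (support n F)"
    unfolding unitrade_def by (auto simp: support_def)
  moreover have "induced_bipartite (hamming_adj n) (support n F)"
    unfolding induced_bipartite_def
  proof (intro exI conjI ballI impI)
    show "{x \<in> Q3 n. F x = 1} \<union> {x \<in> Q3 n. F x = -1} = support n F"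
      unfolding support_def using val by auto
    show "{x \<in> Q3 n. F x = 1} \<inter> {x \<in> Q3 n. F x = -1} = {}" by auto
  next
    fix x y
    assume xy: "x \<in> support n F" "y \<in> support n F" and "hamming_adj n x y"
    then obtain i where i: "i < n" "x i \<noteq> y i" and eq: "\<And>j. j < n \<Longrightarrow> j \<noteq> i \<Longrightarrow> x j = y j"
      unfolding hamming_adj_def by metis
    have Q: "x \<in> Q3 n" "y \<in> Q3 n" using xy unfolding support_def by auto
    have "y = x(i := y i)"
    proof
      fix j
      show "y j = (x(i := y i)) j"
        using eq[of j] Q by (cases "j < n") (auto simp: Q3_def PiE_def extensional_def)
    qed
    moreover have "x = x(i := x i)" by simp
    ultimately have "F x = - F y"
      using signed_bitrade_opposite[OF F i, of x] xy unfolding support_def by auto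
    then show "x \<in> {x \<in> Q3 n. F x = 1} \<and> y \<in> {x \<in> Q3 n. F x = -1} \<or>
        x \<in> {x \<in> Q3 n. F x = -1} \<and> y \<in> {x \<in> Q3 n. F x = 1}"
      using xy val[of x] unfolding support_def by auto
  qed
  ultimately show ?thesis unfolding bitrade_def by blast
qed

section \<open>Layer sizes as an invariant of equivalence\<close>

definition layer_size :: "(nat \<Rightarrow> 3) set \<Rightarrow> nat \<Rightarrow> 3 \<Rightarrow> nat" where
  "layer_size U i a = card {x \<in> U. x i = a}"

text \<open>Taking sets forgets the order of letters and of directions, which are exactly what an
  isometry permutes.\<close>

definition layer_profile :: "nat \<Rightarrow> (nat \<Rightarrow> 3) set \<Rightarrow> nat set set" where
  "layer_profile n U = (\<lambda>i. range (layer_size U i)) ` {..<n}"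

lemma layer_profile_equivalence:
  assumes "(U, V) \<in> equivalence n"
  shows "layer_profile n V \<subseteq> layer_profile n U"
proof -
  obtain f where U: "U \<subseteq> Q3 n" and f: "hamming_isometry n f" and V: "V = f ` U"
    using assms unfolding equivalence_def by blast
  obtain p g where p: "p permutes {..<n}" and g: "\<And>i. i < n \<Longrightarrow> bij (g i)"
    and fx: "\<And>x. x \<in> Q3 n \<Longrightarrow> f x = (\<lambda>i\<in>{..<n}. g i (x (p i)))"
    using f unfolding hamming_isometry_iff by blast
  have "inj_on f U"
    using f U unfolding hamming_isometry_def bij_betw_def by (blast intro: inj_on_subset)
  have "range (layer_size V i) \<in> layer_profile n U" if i: "i < n" for i
  proof -
    have "layer_size V i (g i a) = layer_size U (p i) a" for a
    proof -
      have fxi: "f x i = g i a \<longleftrightarrow> x (p i) = a" if "x \<in> U" for x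
        using fx[of x] U that i g[OF i] by (auto simp: bij_def inj_eq)
      have "{y \<in> V. y i = g i a} = f ` {x \<in> U. x (p i) = a}"
        unfolding V using fxi by auto
      moreover have "inj_on f {x \<in> U. x (p i) = a}"
        using \<open>inj_on f U\<close> by (rule inj_on_subset) auto
      ultimately show ?thesis unfolding layer_size_def by (simp add: card_image)
    qed
    \<comment> \<open>As \<open>g i\<close> is onto the alphabet, the relabelling of letters
      disappears in the range.\<close>
    then have "layer_size V i ` range (g i) = range (layer_size U (p i))"
      by (simp add: image_image)
    then have "range (layer_size V i) = range (layer_size U (p i))"
      using g[OF i] by (simp add: bij_def)
    moreover have "p i < n" using permutes_in_image[OF p, of i] i by simp
    ultimately show ?thesis unfolding layer_profile_def by blast
  qed
  then show ?thesis by (auto simp: layer_profile_def)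
qed

text \<open>Every member of a class has its profile inside that of a representative, so a class
  contributes at most \<open>n\<close> sets.\<close>

lemma card_layer_profiles_le:
  "card (\<Union>U\<in>{U. bitrade n U}. layer_profile n U) \<le> num_bitrade_classes n * n"
proof -
  let ?B = "{U. bitrade n U}" and ?C = "{U. bitrade n U} // equivalence n"
  have sub: "?B \<subseteq> Pow (Q3 n)" unfolding bitrade_def unitrade_def by auto
  then have "finite ?B" by (rule finite_subset) (simp add: finite_Q3)
  then have fin: "finite ?C" unfolding quotient_def by auto
  have prof: "card (layer_profile n U) \<le> n" "finite (layer_profile n U)" for U
    unfolding layer_profile_def using card_image_le[of "{..<n}"] by auto
  have le: "card (\<Union>V\<in>C. layer_profile n V) \<le> n" if "C \<in> ?C" for C
  proof -
    obtain U where "C = equivalence n `` {U}" using \<open>C \<in> ?C\<close> by (rule quotientE)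
    then have "(\<Union>V\<in>C. layer_profile n V) \<subseteq> layer_profile n U"
      using layer_profile_equivalence by blast
    then show ?thesis using prof[of U] by (meson card_mono order.trans)
  qed
  have "(\<Union>U\<in>?B. layer_profile n U) \<subseteq> (\<Union>C\<in>?C. \<Union>V\<in>C. layer_profile n V)"
  proof (intro UN_least)
    fix U assume U: "U \<in> ?B"
    have "U \<in> equivalence n `` {U}"
      using equiv_class_self[OF equiv_equivalence] U sub by blast
    then show "layer_profile n U \<subseteq> (\<Union>C\<in>?C. \<Union>V\<in>C. layer_profile n V)"
      using quotientI[OF U, of "equivalence n"] by blast
  qed
  moreover have "finite (\<Union>C\<in>?C. \<Union>V\<in>C. layer_profile n V)"
  proof (rule finite_UN_I[OF fin])
    fix C assume "C \<in> ?C"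
    then obtain U where "C = equivalence n `` {U}" by (rule quotientE)
    then have "(\<Union>V\<in>C. layer_profile n V) \<subseteq> layer_profile n U"
      using layer_profile_equivalence by blast
    then show "finite (\<Union>V\<in>C. layer_profile n V)" using prof(2) by (rule finite_subset)
  qed
  ultimately have "card (\<Union>U\<in>?B. layer_profile n U) \<le> card (\<Union>C\<in>?C. \<Union>V\<in>C. layer_profile n V)"
    by (rule card_mono[rotated])
  also have "\<dots> \<le> (\<Sum>C\<in>?C. card (\<Union>V\<in>C. layer_profile n V))"
    using fin by (rule card_UN_le)
  also have "\<dots> \<le> card ?C * n"
    using sum_bounded_above[of ?C "\<lambda>C. card (\<Union>V\<in>C. layer_profile n V)" n] le by simp
  finally show ?thesis unfolding num_bitrade_classes_def .
qed

section \<open>Adding one coordinate\<close>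

lemma card_Q3_layer:
  "card {x \<in> Q3 (Suc n). P x \<and> x n = a} = card {x \<in> Q3 n. P (x(n := a))}"
proof (rule sym, rule bij_betw_same_card[of "\<lambda>x. x(n := a)"], rule bij_betw_imageI)
  show "inj_on (\<lambda>x. x(n := a)) {x \<in> Q3 n. P (x(n := a))}"
  proof (rule inj_onI)
    fix x y :: "nat \<Rightarrow> 3"
    assume xy: "x \<in> {x \<in> Q3 n. P (x(n := a))}" "y \<in> {x \<in> Q3 n. P (x(n := a))}"
      and eq: "x(n := a) = y(n := a)"
    \<comment> \<open>Words of length \<open>n\<close> share the default value at position
      \<open>n\<close>, so overwriting it loses nothing.\<close>
    then have "x n = undefined" "y n = undefined" by (auto simp: Q3_def)
    then show "x = y" using eq by (metis fun_upd_triv fun_upd_upd)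
  qed
  show "(\<lambda>x. x(n := a)) ` {x \<in> Q3 n. P (x(n := a))} = {x \<in> Q3 (Suc n). P x \<and> x n = a}"
  proof (intro equalityI subsetI)
    fix y assume "y \<in> (\<lambda>x. x(n := a)) ` {x \<in> Q3 n. P (x(n := a))}"
    then show "y \<in> {x \<in> Q3 (Suc n). P x \<and> x n = a}"
      by (auto simp: Q3_def PiE_def extensional_def)
  next
    fix y assume y: "y \<in> {x \<in> Q3 (Suc n). P x \<and> x n = a}"
    then have "y(n := undefined) \<in> Q3 n" "y = (y(n := undefined))(n := a)"
      by (auto simp: Q3_def PiE_def extensional_def)
    then show "y \<in> (\<lambda>x. x(n := a)) ` {x \<in> Q3 n. P (x(n := a))}"
      using y by (intro image_eqI[of _ _ "y(n := undefined)"]) auto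
  qed
qed

lemma card_Q3_Suc:
  "card {x \<in> Q3 (Suc n). P x} = card {x \<in> Q3 n. P (x(n := 0))} +
     card {x \<in> Q3 n. P (x(n := 1))} + card {x \<in> Q3 n. P (x(n := 2))}"
proof -
  let ?L = "\<lambda>a. {x \<in> Q3 (Suc n). P x \<and> x n = a}"
  have fin: "finite (?L a)" for a by (simp add: finite_Q3)
  have "{x \<in> Q3 (Suc n). P x} = ?L 0 \<union> ?L 1 \<union> ?L 2"
    using exhaust_three by auto
  moreover have "(?L 0 \<union> ?L 1) \<inter> ?L 2 = {}" "?L 0 \<inter> ?L 1 = {}" by auto
  ultimately have "card {x \<in> Q3 (Suc n). P x} = card (?L 0) + card (?L 1) + card (?L 2)"
    using fin by (simp only: card_Un_disjoint finite_Un simp_thms)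
  then show ?thesis by (simp only: card_Q3_layer)
qed

text \<open>Rows are the letters at \<open>Suc n\<close>, columns those at \<open>n\<close>. In rows
  1 and 2, \<open>p\<close> is the index of the layer of \<open>F\<close> that is reused: its
  negative stays in column \<open>p\<close>, a copy moves to column \<open>j\<close>.\<close>

definition extend :: "bool \<Rightarrow> nat \<Rightarrow> ((nat \<Rightarrow> 3) \<Rightarrow> int) \<Rightarrow> (nat \<Rightarrow> 3) \<Rightarrow> int" where
  "extend b n F x =
     (let k = (if b then 1 else 2); j = (if b then 2 else 1); p = (if x (Suc n) = 1 then 0 else k)
      in if x (Suc n) = 0 then F x
         else if x n = p then - F x
         else if x n = j then F (x(n := p)) else 0)"

text \<open>Across rows, columns 0 and \<open>k\<close> cancel and column \<open>j\<close> collects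
  all three layers of \<open>F\<close>. Along direction \<open>n\<close>, a row is a line of
  \<open>F\<close> or a cancelling pair. In the older directions every cell is zero or a layer of
  \<open>F\<close> up to sign.\<close>

lemma signed_bitrade_extend:
  assumes F: "signed_bitrade (Suc n) F"
  shows "signed_bitrade (Suc (Suc n)) (extend b n F)"
proof -
  have val: "F x \<in> {-1, 0, 1}" for x
    using F unfolding signed_bitrade_def by blast
  have const: "F (x(i := a)) = F x" if "i \<ge> Suc n" for x i a
    using F that unfolding signed_bitrade_def by blast
  have zero: "F (x(i := 0)) + F (x(i := 1)) + F (x(i := 2)) = 0" if "i < Suc n" for x i
    using F that unfolding signed_bitrade_def by blast
  have const': "F (x(Suc n := a, n := c)) = F (x(n := c))" for x a c
    using const[of "Suc n" "x(n := c)" a] by (simp add: fun_upd_twist)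
  have "- a \<in> {-1, 0, 1}" if "a \<in> {-1, 0, 1}" for a :: int
    using that by auto
  then have "extend b n F x \<in> {-1, 0, 1}" for x
    unfolding extend_def Let_def using val by (auto split: if_splits)
  moreover have "extend b n F (x(i := a)) = extend b n F x" if "i \<ge> Suc (Suc n)" for x i a
    using that const[of i x a] const[of i "x(n := c)" a for c]
    by (simp add: extend_def Let_def fun_upd_twist[of i n])
  moreover have "extend b n F (x(i := 0)) + extend b n F (x(i := 1)) + extend b n F (x(i := 2)) = 0"
    if i: "i < Suc (Suc n)" for x i
  proof -
    consider "i = Suc n" | "i = n" | "i < n" using i by linarith
    then show ?thesis
    proof cases
      case 1
      have triv: "F (x(n := c)) = F x" if "x n = c" for c
        using that by (metis fun_upd_triv)
      show ?thesis
        using exhaust_three[of "x n"] zero[of n x] triv[of 1] triv[of 2]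
        by (cases b) (auto simp: 1 extend_def Let_def const const' fun_upd_twist)
    next
      case 2
      show ?thesis
        using exhaust_three[of "x (Suc n)"] zero[of n x]
        by (cases b) (auto simp: 2 extend_def Let_def)
    next
      case 3
      then show ?thesis
        using zero[of i x] zero[of i "x(n := c)" for c]
        by (auto simp: extend_def Let_def fun_upd_twist[of i n])
    qed
  qed
  ultimately show ?thesis unfolding signed_bitrade_def by blast
qed

text \<open>Meant for \<open>F\<close> with \<open>Suc n\<close> coordinates, the last of which is
  numbered \<open>n\<close>.\<close>

definition last_sizes :: "nat \<Rightarrow> ((nat \<Rightarrow> 3) \<Rightarrow> int) \<Rightarrow> 3 \<Rightarrow> nat" where
  "last_sizes n F a = card {x \<in> Q3 n. F (x(n := a)) \<noteq> 0}"

lemma layer_size_support: "layer_size (support (Suc n) F) n = last_sizes n F"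
  unfolding layer_size_def support_def last_sizes_def
  using card_Q3_layer[of n "\<lambda>x. F x \<noteq> 0"] by auto

text \<open>Row 0 is \<open>F\<close> itself; rows 1 and 2 each hold a single layer of
  \<open>F\<close> twice, up to sign.\<close>

lemma last_sizes_extend:
  assumes F: "signed_bitrade (Suc n) F"
  shows "last_sizes (Suc n) (extend b n F) 0 = last_sizes n F 0 + last_sizes n F 1 + last_sizes n F 2"
    and "last_sizes (Suc n) (extend b n F) 1 = 2 * last_sizes n F 0"
    and "last_sizes (Suc n) (extend b n F) 2 = 2 * last_sizes n F (if b then 1 else 2)"
proof -
  have const: "F (x(Suc n := a)) = F x" for x a
    using F unfolding signed_bitrade_def by blast
  have const': "F (x(Suc n := a, n := c)) = F (x(n := c))" for x a c
    using const[of "x(n := c)" a] by (simp add: fun_upd_twist)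
  show "last_sizes (Suc n) (extend b n F) 0 = last_sizes n F 0 + last_sizes n F 1 + last_sizes n F 2"
    unfolding last_sizes_def card_Q3_Suc by (simp add: extend_def const)
  show "last_sizes (Suc n) (extend b n F) 1 = 2 * last_sizes n F 0"
    unfolding last_sizes_def card_Q3_Suc
    by (cases b) (simp_all add: extend_def const const')
  show "last_sizes (Suc n) (extend b n F) 2 = 2 * last_sizes n F (if b then 1 else 2)"
    unfolding last_sizes_def card_Q3_Suc
    by (cases b) (simp_all add: extend_def const const')
qed

section \<open>Bitrades indexed by words of choices\<close>

fun word_trade :: "bool list \<Rightarrow> (nat \<Rightarrow> 3) \<Rightarrow> int" where
  "word_trade [] = (\<lambda>x. if x 0 = 0 then 1 else if x 0 = 1 then -1 else 0)"
| "word_trade (b # w) = extend b (length w) (word_trade w)"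

fun word_sizes :: "bool list \<Rightarrow> nat \<times> nat \<times> nat" where
  "word_sizes [] = (1, 1, 0)"
| "word_sizes (b # w) = (case word_sizes w of (x, y, z) \<Rightarrow>
     (x + y + z, 2 * x, 2 * (if b then y else z)))"

lemma signed_bitrade_word_trade: "signed_bitrade (Suc (length w)) (word_trade w)"
proof (induction w)
  case Nil
  show ?case by (auto simp: signed_bitrade_def)
next
  case (Cons b w)
  then show ?case by (simp add: signed_bitrade_extend)
qed

lemma last_sizes_word_trade:
  "word_sizes w = (last_sizes (length w) (word_trade w) 0,
     last_sizes (length w) (word_trade w) 1, last_sizes (length w) (word_trade w) 2)"
proof (induction w)
  case Nil
  show ?case by (simp add: last_sizes_def Q3_def)
next
  case (Cons b w)
  then show ?case
    by (simp add: last_sizes_extend[OF signed_bitrade_word_trade])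
qed

text \<open>The suffix takes the layer sizes from \<open>(1, 1, 0)\<close> to \<open>(14, 12, 8)\<close>, where the three 2-adic
  valuations are distinct.\<close>

abbreviation seeded :: "bool list \<Rightarrow> bool list" where
  "seeded w \<equiv> w @ [True, True, True]"

lemma word_sizes_mod:
  assumes "word_sizes (seeded w) = (x, y, z)"
  shows "x mod 4 = 2 \<and> y mod 8 = 4 \<and> z mod 8 = 0"
  using assms
proof (induction w arbitrary: x y z)
  case Nil
  then show ?case by simp
next
  case (Cons b w)
  obtain x' y' z' where s: "word_sizes (seeded w) = (x', y', z')"
    by (metis prod_cases3)
  \<comment> \<open>Residues modulo 4 suffice: \<open>y'\<close> and \<open>z'\<close> do not affect
    \<open>x\<close> modulo 4, and doubling lifts residues modulo 4 to residues modulo 8.\<close>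
  have x': "x' mod 4 = 2" and y': "y' mod 4 = 0" and z': "z' mod 4 = 0"
    using Cons.IH[OF s] by presburger+
  have x: "x = x' + y' + z'" and y: "y = 2 * x'" and z: "z = 2 * (if b then y' else z')"
    using Cons.prems s by simp_all
  have "x mod 4 = ((x' mod 4 + y' mod 4) mod 4 + z' mod 4) mod 4"
    unfolding x by (simp only: mod_add_eq)
  then have "x mod 4 = 2" using x' y' z' by simp
  moreover have "y mod 8 = 4"
    unfolding y using mult_mod_right[of 2 x' 4] x' by simp
  moreover have "z mod 8 = 0"
    unfolding z using mult_mod_right[of 2 y' 4] mult_mod_right[of 2 z' 4] y' z' by (cases b) simp_all
  ultimately show ?case by blast
qed

text \<open>The last step can be undone: half of the third entry is 4 modulo 8 if the choice was
  \<open>True\<close> and 0 otherwise. This reveals the choice and one old entry; half of the second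
  entry is the old first one, and the sum gives the remaining one.\<close>

lemma word_sizes_inj:
  assumes "length v = length w" and "word_sizes (seeded v) = word_sizes (seeded w)"
  shows "v = w"
  using assms
proof (induction v w rule: list_induct2)
  case Nil
  show ?case by simp
next
  case (Cons b v c w)
  obtain x y z where s: "word_sizes (seeded v) = (x, y, z)" by (metis prod_cases3)
  obtain x' y' z' where s': "word_sizes (seeded w) = (x', y', z')" by (metis prod_cases3)
  have "b = c \<and> word_sizes (seeded v) = word_sizes (seeded w)"
    using Cons.prems word_sizes_mod[OF s] word_sizes_mod[OF s'] s s'
    by (cases b; cases c) auto
  then show ?case using Cons.IH by simp
qed

definition word_set :: "bool list \<Rightarrow> nat set" where
  "word_set w = (case word_sizes w of (x, y, z) \<Rightarrow> {x, y, z})"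

text \<open>Modulo 8 the entries are 2 or 6, then 4, then 0, so the unordered set already determines
  the triple.\<close>

lemma word_set_inj:
  assumes "length v = length w" and eq: "word_set (seeded v) = word_set (seeded w)"
  shows "v = w"
proof -
  obtain x y z where s: "word_sizes (seeded v) = (x, y, z)" by (metis prod_cases3)
  obtain x' y' z' where s': "word_sizes (seeded w) = (x', y', z')" by (metis prod_cases3)
  have m: "x mod 8 \<noteq> 0" "x mod 8 \<noteq> 4" "x' mod 8 \<noteq> 0" "x' mod 8 \<noteq> 4"
    "y mod 8 = 4" "y' mod 8 = 4" "z mod 8 = 0" "z' mod 8 = 0"
    using word_sizes_mod[OF s] word_sizes_mod[OF s'] by presburger+
  have eq': "{x, y, z} = {x', y', z'}" using eq s s' by (simp add: word_set_def)
  have "x \<in> {x', y', z'}" "y \<in> {x', y', z'}" "z \<in> {x', y', z'}"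
    using eq' by auto
  then have "x = x'" "y = y'" "z = z'" using m by auto
  then show ?thesis using word_sizes_inj[OF assms(1)] s s' by simp
qed

lemma word_set_in_profile:
  "word_set w \<in> layer_profile (Suc (length w)) (support (Suc (length w)) (word_trade w))"
proof -
  have "word_set w = range (layer_size (support (Suc (length w)) (word_trade w)) (length w))"
    unfolding word_set_def layer_size_support UNIV_three by (simp add: last_sizes_word_trade)
  then show ?thesis unfolding layer_profile_def by blast
qed

section \<open>Counting classes and the asymptotic bound\<close>

lemma num_bitrade_classes_ge: "2 ^ m \<le> num_bitrade_classes (m + 4) * (m + 4)"
proof -
  let ?W = "{w :: bool list. length w = m}"
  let ?P = "\<Union>U\<in>{U. bitrade (m + 4) U}. layer_profile (m + 4) U"
  have "card ?W = 2 ^ m"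
    using card_lists_length_eq[of "UNIV :: bool set" m] by simp
  moreover have "inj_on (\<lambda>w. word_set (seeded w)) ?W"
    using word_set_inj by (intro inj_onI) auto
  ultimately have "2 ^ m = card ((\<lambda>w. word_set (seeded w)) ` ?W)"
    by (simp add: card_image)
  also have "\<dots> \<le> card ?P"
  proof (rule card_mono)
    have "{U. bitrade (m + 4) U} \<subseteq> Pow (Q3 (m + 4))"
      unfolding bitrade_def unitrade_def by auto
    then have "finite {U. bitrade (m + 4) U}"
      by (rule finite_subset) (simp add: finite_Q3)
    then show "finite ?P" by (simp add: layer_profile_def)
    show "(\<lambda>w. word_set (seeded w)) ` ?W \<subseteq> ?P"
    proof (rule image_subsetI)
      fix w assume "w \<in> ?W"
      \<comment> \<open>One starting coordinate, three for the fixed suffix, and one for each of the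
        \<open>m\<close> free choices.\<close>
      then have "Suc (length (seeded w)) = m + 4" by simp
      then show "word_set (seeded w) \<in> ?P"
        using word_set_in_profile[of "seeded w"]
          bitrade_support[OF signed_bitrade_word_trade[of "seeded w"]]
        by (intro UN_I[of "support (m + 4) (word_trade (seeded w))"]) (simp_all only: mem_Collect_eq)
    qed
  qed
  also have "\<dots> \<le> num_bitrade_classes (m + 4) * (m + 4)"
    by (rule card_layer_profiles_le)
  finally show ?thesis .
qed

theorem mainTheorem5:
  shows "\<forall>\<epsilon>::real. \<epsilon> > 0 \<longrightarrow>
    (\<exists>n\<^sub>0::nat. \<forall>n\<ge>n\<^sub>0. real (num_bitrade_classes n) \<ge> 2 powr ((2 / 3 - \<epsilon>) * real n))"
proof (intro allI impI)
  fix \<epsilon> :: real assume "\<epsilon> > 0"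
  \<comment> \<open>The right side is \<open>2 ^ (n - 4) / n\<close> for \<open>n \<ge> 4\<close>,
    the count just obtained; its exponential rate 1 exceeds 2/3, which absorbs the factor
    \<open>16 * n\<close>.\<close>
  have "eventually (\<lambda>n::nat. 2 powr (2 / 3 * real n) \<le> 2 ^ n / (16 * real n)) sequentially"
    by real_asymp
  then obtain N :: nat where N: "\<And>n. n \<ge> N \<Longrightarrow> 2 powr (2 / 3 * real n) \<le> 2 ^ n / (16 * real n)"
    unfolding eventually_sequentially by blast
  have "2 powr ((2 / 3 - \<epsilon>) * real n) \<le> real (num_bitrade_classes n)" if n: "n \<ge> max N 4" for n
  proof -
    obtain m where m: "n = m + 4" using n by (metis add.commute le_Suc_ex max.bounded_iff)
    have "2 powr ((2 / 3 - \<epsilon>) * real n) \<le> 2 powr (2 / 3 * real n)"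
      using \<open>\<epsilon> > 0\<close> by (intro powr_mono mult_right_mono) auto
    also have "\<dots> \<le> 2 ^ n / (16 * real n)" using N n by simp
    also have "\<dots> = 2 ^ m / real n"
    proof -
      have "(2 :: real) ^ n = 16 * 2 ^ m" by (simp add: m power_add)
      then show ?thesis by simp
    qed
    also have "\<dots> \<le> real (num_bitrade_classes n)"
    proof -
      have "real (2 ^ m) \<le> real (num_bitrade_classes n * n)"
        using num_bitrade_classes_ge[of m] unfolding m of_nat_le_iff .
      then show ?thesis using m by (simp add: divide_le_eq)
    qed
    finally show ?thesis .
  qed
  then show "\<exists>n\<^sub>0. \<forall>n\<ge>n\<^sub>0. real (num_bitrade_classes n) \<ge> 2 powr ((2 / 3 - \<epsilon>) * real n)"
    by blast
qed

end
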